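(* Let $n\ge 2$, $m\ge 1$, and let $\beta_1,\dots,\beta_m>0$ with $\sum_{j=1}^m\beta_j=1$. For $j=1,\dots,m$ let $\mu_j\in\mathbb{R}^n$, let $\Sigma_j$ be a symmetric positive definite real $n\times n$ matrix, and let $g_j:[0,\infty)\to[0,\infty)$ be an integrable function such that $$f_j(x)=|\Sigma_j|^{-1/2}\,g_j\big((x-\mu_j)\Sigma_j^{-1}(x-\mu_j)^t\big)$$ is a probability density on $\mathbb{R}^n$. Suppose that the $g_j$ never vanish jointly, i.e. there is no $s\ge 0$ with $g_1(s)=\cdots=g_m(s)=0$. Let $X=(X_1,\dots,X_n)$ be a random vector with density $f(x)=\sum_{j=1}^m\beta_jf_j(x)$, let $\delta=(\delta_1,\dots,\delta_n)\in\mathbb{R}^n$, $\delta\ne0$, and let $\Delta\Pi=\delta_1X_1+\cdots+\delta_nX_n$. Let $0<\alpha<1$. Then the Value-at-Risk $VaR_\alpha$ of $\Delta\Pi$ at confidence $1-\alpha$ is given as the solution of the equation $$\alpha=\sum_{j=1}^m\beta_j\,G_j\left(\frac{\delta\cdot\mu_j+VaR_\alpha}{(\delta\Sigma_j\delta^t)^{1/2}}\right),$$ where, for $s\in\mathbb{R}$, $$G_j(s)=\frac{2\pi^{\frac{n-1}{2}}}{\Gamma\left(\frac{n-1}{2}\right)}\int_{-\infty}^{-s}\left[\int_0^{\infty}r^{n-2}\,g_j(z_1^2+r^2)\,dr\right]dz_1 .$$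
   Context: Vectors $x\in\mathbb{R}^n$ are row vectors, $x^t$ is the transpose, $x\cdot y=xy^t$ is the Euclidean inner product, and $|\Sigma_j|$ is the determinant of $\Sigma_j$. $\Gamma$ is the Gamma function. The Value-at-Risk at confidence $1-\alpha$ of a portfolio with profit and loss $\Delta\Pi$ is the number $VaR_\alpha$ solving $\mathrm{Prob}\{\Delta\Pi<-VaR_\alpha\}=\alpha$. The distribution of $X$ is called a mixture of $m$ elliptic distributions with weights $\beta_j$. *)

theory Defs
  imports "HOL-Probability.Probability"
begin

(* Vectors are row vectors, so the quadratic form x A x^t is written (x v* A) \<bullet> x. *)

definition sym_pos_def :: "real ^ 'n ^ 'n \<Rightarrow> bool" where
  "sym_pos_def A \<longleftrightarrow> transpose A = A \<and> (\<forall>x. x \<noteq> 0 \<longrightarrow> 0 < (x v* A) \<bullet> x)"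

definition is_probability_density :: "('a::euclidean_space \<Rightarrow> real) \<Rightarrow> bool" where
  "is_probability_density f \<longleftrightarrow>
     f \<in> borel_measurable borel \<and> (\<forall>x. 0 \<le> f x) \<and> (\<integral>\<^sup>+ x. ennreal (f x) \<partial>lborel) = 1"

definition elliptic_density ::
    "real ^ 'n \<Rightarrow> real ^ 'n ^ 'n \<Rightarrow> (real \<Rightarrow> real) \<Rightarrow> real ^ 'n \<Rightarrow> real" where
  "elliptic_density \<mu> S g x =
     det S powr (- 1 / 2) * g (((x - \<mu>) v* matrix_inv S) \<bullet> (x - \<mu>))"

(* Meaningful only if exactly one v satisfies the equation. *)
definition value_at_risk :: "'a measure \<Rightarrow> ('a \<Rightarrow> real) \<Rightarrow> real \<Rightarrow> real" where
  "value_at_risk M Y \<alpha> = (THE v. measure M {\<omega> \<in> space M. Y \<omega> < - v} = \<alpha>)"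

(* For n = 2 the inner integral may diverge on a null set of z; the Bochner
   integral is 0 there, which does not affect the outer integral. *)
definition elliptic_tail :: "nat \<Rightarrow> (real \<Rightarrow> real) \<Rightarrow> real \<Rightarrow> real" where
  "elliptic_tail n g s =
     2 * pi powr ((real n - 1) / 2) / Gamma ((real n - 1) / 2) *
     (LBINT z:{..- s}. (LBINT r:{0..}. r ^ (n - 2) * g (z\<^sup>2 + r\<^sup>2)))"

end

theory Submission
  imports Defs
begin

text \<open>
  The portfolio value is a linear functional \<open>\<delta> \<bullet> X\<close>, so only its one-dimensional law matters.
  For a single elliptic component with location \<open>\<mu>\<close> and matrix \<open>A\<close>, an affine substitution
  \<open>x = \<mu> + T z\<close> turns the quadratic form into \<open>z \<bullet> z\<close> and \<open>\<delta> \<bullet> x\<close> into \<open>\<delta> \<bullet> \<mu> + \<sigma> * z $ k\<close> with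
  \<open>\<sigma> = sqrt ((\<delta> v* A) \<bullet> \<delta>)\<close> (\<open>sym_pos_def_whitening\<close>); its determinant \<open>sqrt (det A)\<close> cancels
  the factor in the density. Fixing the coordinate \<open>k\<close> and using polar coordinates in the other
  \<open>n - 1\<close> coordinates shows that \<open>\<delta> \<bullet> X\<close> is distributed as \<open>\<delta> \<bullet> \<mu> + \<sigma> z\<close>, where \<open>z\<close> has the
  density \<open>sphere_area (n - 1) * (\<integral>r. r ^ (n - 2) * g (z\<^sup>2 + r\<^sup>2))\<close>
  (\<open>elliptic_density_projection\<close>). The probability of \<open>\<delta> \<bullet> X < - v\<close> is therefore \<open>elliptic_tail\<close>
  at \<open>(\<delta> \<bullet> \<mu> + v) / \<sigma>\<close>, and a mixture gives the weighted sum.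

  It remains to see that exactly one \<open>v\<close> has \<open>Prob {\<delta> \<bullet> X < - v} = \<alpha>\<close>; without this,
  \<open>value_at_risk\<close> would not be tied to the equation. The law has no atoms, so its distribution
  function is continuous. It is strictly increasing even though the density of \<open>X\<close> may vanish in
  places, the quadratic forms of the components being different: a strip of probability zero
  forces every \<open>g j\<close> to vanish almost everywhere beyond some bound, since a hyperplane meets all
  large radii, and then all \<open>g j\<close> vanish together at some \<open>s\<close> (\<open>jointly_zero_if_strips_null\<close>).
\<close>

section \<open>Linear substitution in Lebesgue integrals\<close>

lemma bij_betw_axis_Basis: "bij_betw (\<lambda>i::'n::finite. axis i 1) UNIV (Basis :: (real^'n) set)"
  by (auto simp: bij_betw_def inj_def axis_eq_axis Basis_vec_def)

lemma prod_Basis_cart: "(\<Prod>b\<in>(Basis :: (real^'n) set). f b) = (\<Prod>i\<in>UNIV. f (axis i 1))"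
  by (rule prod.reindex_bij_betw[OF bij_betw_axis_Basis, symmetric])

lemma sum_Basis_cart: "(\<Sum>b\<in>(Basis :: (real^'n) set). f b) = (\<Sum>i\<in>UNIV. f (axis i 1))"
  by (rule sum.reindex_bij_betw[OF bij_betw_axis_Basis, symmetric])

lemma borel_measurable_vec_lambda:
  fixes f :: "'n::finite \<Rightarrow> 'a \<Rightarrow> real"
  assumes "\<And>i. f i \<in> borel_measurable M"
  shows "(\<lambda>x. \<chi> i. f i x) \<in> borel_measurable M"
proof (rule borel_measurable_euclidean_space[THEN iffD2], rule ballI)
  fix b :: "real^'n" assume "b \<in> Basis"
  then obtain i where "b = axis i 1" by (auto simp: Basis_vec_def)
  then show "(\<lambda>x. (\<chi> i. f i x) \<bullet> b) \<in> borel_measurable M"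
    using assms by (simp add: inner_axis)
qed

text \<open>
  Indexing the product measure by coordinates instead of basis vectors lets one coordinate be
  separated from the others without translating between \<open>i\<close> and \<open>axis i 1\<close>.
\<close>
lemma lborel_vec_eq_PiM:
  "(lborel :: (real^'n) measure) = distr (\<Pi>\<^sub>M i\<in>UNIV. lborel) borel (\<lambda>f. \<chi> i. f i)"
proof (rule lborel_eqI)
  interpret product_sigma_finite "\<lambda>_::'n. lborel :: real measure" by standard
  have m: "(\<lambda>f. \<chi> i. f i) \<in> (\<Pi>\<^sub>M i\<in>(UNIV::'n set). lborel) \<rightarrow>\<^sub>M (borel :: (real^'n) measure)"
    by (rule borel_measurable_vec_lambda) simp
  fix l u :: "real^'n" assume le: "\<And>b. b \<in> Basis \<Longrightarrow> l \<bullet> b \<le> u \<bullet> b"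
  have le': "l $ i \<le> u $ i" for i
    using le[of "axis i 1"] by (simp add: inner_axis)
  have "emeasure (distr (\<Pi>\<^sub>M i\<in>UNIV. lborel) borel (\<lambda>f. \<chi> i. f i)) (box l u)
      = emeasure (\<Pi>\<^sub>M i\<in>(UNIV::'n set). lborel) (\<Pi>\<^sub>E i\<in>UNIV. {l $ i <..< u $ i})"
    by (subst emeasure_distr[OF m])
       (auto intro!: arg_cong2[where f=emeasure] simp: space_PiM mem_box_cart PiE_def Pi_def)
  also have "\<dots> = (\<Prod>i\<in>UNIV. ennreal (u $ i - l $ i))"
    by (subst emeasure_PiM) (auto simp: le')
  also have "\<dots> = (\<Prod>i\<in>UNIV. u $ i - l $ i)"
    by (rule prod_ennreal) (simp add: le')
  also have "(\<Prod>i\<in>UNIV. u $ i - l $ i) = (\<Prod>b\<in>Basis. (u - l) \<bullet> b)"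
    by (simp add: prod_Basis_cart inner_axis)
  finally show "emeasure (distr (\<Pi>\<^sub>M i\<in>UNIV. lborel) borel (\<lambda>f. \<chi> i. f i)) (box l u)
    = (\<Prod>b\<in>Basis. (u - l) \<bullet> b)" .
qed simp

lemma nn_integral_lborel_vec_split:
  fixes h :: "real^'n \<Rightarrow> ennreal"
  assumes h: "h \<in> borel_measurable borel"
  shows "(\<integral>\<^sup>+x. h x \<partial>lborel)
    = (\<integral>\<^sup>+x. \<integral>\<^sup>+t. h (\<chi> i. if i = k then t else x i) \<partial>lborel \<partial>(\<Pi>\<^sub>M i\<in>UNIV - {k}. lborel))"
    and "(\<integral>\<^sup>+x. h x \<partial>lborel)
    = (\<integral>\<^sup>+t. \<integral>\<^sup>+x. h (\<chi> i. if i = k then t else x i) \<partial>(\<Pi>\<^sub>M i\<in>UNIV - {k}. lborel) \<partial>lborel)"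
proof -
  interpret product_sigma_finite "\<lambda>_::'n. lborel :: real measure" by standard
  have m: "(\<lambda>f. \<chi> i. f i) \<in> (\<Pi>\<^sub>M i\<in>(UNIV::'n set). lborel) \<rightarrow>\<^sub>M (borel :: (real^'n) measure)"
    by (rule borel_measurable_vec_lambda) simp
  have ins: "insert k (UNIV - {k}) = (UNIV :: 'n set)" by auto
  have hm: "(\<lambda>f. h (\<chi> i. f i)) \<in> borel_measurable (\<Pi>\<^sub>M i\<in>insert k (UNIV - {k}). lborel)"
    unfolding ins using measurable_compose[OF m h] .
  have "(\<integral>\<^sup>+x. h x \<partial>lborel) = (\<integral>\<^sup>+f. h (\<chi> i. f i) \<partial>(\<Pi>\<^sub>M i\<in>insert k (UNIV - {k}). lborel))"
    unfolding ins by (subst lborel_vec_eq_PiM, subst nn_integral_distr[OF m]) (use h in simp_all)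
  note eq = this
  have upd: "(\<chi> i. (x(k := t)) i) = (\<chi> i. if i = k then t else x i)" for x and t :: real
    by (simp add: vec_eq_iff)
  show "(\<integral>\<^sup>+x. h x \<partial>lborel)
    = (\<integral>\<^sup>+x. \<integral>\<^sup>+t. h (\<chi> i. if i = k then t else x i) \<partial>lborel \<partial>(\<Pi>\<^sub>M i\<in>UNIV - {k}. lborel))"
    unfolding eq by (subst product_nn_integral_insert[OF _ _ hm]) (simp_all add: upd)
  show "(\<integral>\<^sup>+x. h x \<partial>lborel)
    = (\<integral>\<^sup>+t. \<integral>\<^sup>+x. h (\<chi> i. if i = k then t else x i) \<partial>(\<Pi>\<^sub>M i\<in>UNIV - {k}. lborel) \<partial>lborel)"
    unfolding eq by (subst product_nn_integral_insert_rev[OF _ _ hm]) (simp_all add: upd)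
qed

lemma borel_measurable_matrix_vector_mult:
  "(\<lambda>x. A *v x) \<in> borel_measurable (borel :: (real^'n) measure)" for A :: "real^'n^'m"
  by (intro borel_measurable_continuous_onI linear_continuous_on matrix_vector_mul_bounded_linear)

lemma nn_integral_diagonal:
  fixes A :: "real^'n^'n"
  assumes h: "h \<in> borel_measurable borel" and diag: "\<And>i j. i \<noteq> j \<Longrightarrow> A $ i $ j = 0"
    and "invertible A"
  shows "(\<integral>\<^sup>+x. h x \<partial>lborel) = ennreal \<bar>det A\<bar> * (\<integral>\<^sup>+x. h (A *v x) \<partial>lborel)"
proof -
  have det: "det A = (\<Prod>i\<in>UNIV. A $ i $ i)"
    using diag by (rule det_diagonal)
  with \<open>invertible A\<close> have nz: "A $ i $ i \<noteq> 0" for i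
    by (auto simp: invertible_det_nz)
  define c :: "real^'n \<Rightarrow> real" where "c b = A $ axis_index b $ axis_index b" for b
  have cnz: "c b \<noteq> 0" for b
    using nz by (simp add: c_def)
  have T: "0 + (\<Sum>b\<in>Basis. (c b * (x \<bullet> b)) *\<^sub>R b) = A *v x" for x
  proof -
    have "(A *v x) $ i = A $ i $ i * x $ i" for i
      unfolding matrix_vector_mult_def
      by (simp add: sum.remove[of UNIV i] diag)
    then show ?thesis
      by (simp add: vec_eq_iff sum_Basis_cart c_def inner_axis) (simp add: axis_def if_distrib cong: if_cong)
  qed
  have "(lborel :: (real^'n) measure) = density (distr lborel borel (\<lambda>x. A *v x)) (\<lambda>_. ennreal \<bar>det A\<bar>)"
    using lborel_affine_euclidean[of c 0] cnz
    unfolding T by (simp add: prod_Basis_cart c_def det abs_prod)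
  then have "(\<integral>\<^sup>+x. h x \<partial>lborel)
      = (\<integral>\<^sup>+x. h x \<partial>density (distr lborel borel (\<lambda>x. A *v x)) (\<lambda>_. ennreal \<bar>det A\<bar>))"
    by simp
  also have "\<dots> = ennreal \<bar>det A\<bar> * (\<integral>\<^sup>+x. h (A *v x) \<partial>lborel)"
    using h borel_measurable_matrix_vector_mult[of A]
    by (simp add: nn_integral_density nn_integral_distr nn_integral_cmult)
  finally show ?thesis .
qed

lemma nn_integral_permute_coordinates:
  fixes h :: "real^'n \<Rightarrow> ennreal" and p :: "'n \<Rightarrow> 'n"
  assumes h: "h \<in> borel_measurable borel" and p: "bij p"
  shows "(\<integral>\<^sup>+x. h x \<partial>lborel) = (\<integral>\<^sup>+x. h (\<chi> i. x $ p i) \<partial>lborel)"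
proof -
  have m: "(\<lambda>x::real^'n. \<chi> i. x $ p i) \<in> borel_measurable borel"
    by (rule borel_measurable_vec_lambda) simp
  have "(lborel :: (real^'n) measure) = distr lborel borel (\<lambda>x. \<chi> i. x $ p i)"
  proof (rule lborel_eqI)
    fix l u :: "real^'n" assume le: "\<And>b. b \<in> Basis \<Longrightarrow> l \<bullet> b \<le> u \<bullet> b"
    have le': "l $ i \<le> u $ i" for i
      using le[of "axis i 1"] by (simp add: inner_axis)
    let ?q = "\<lambda>v::real^'n. \<chi> i. v $ inv p i"
    have pq: "p (inv p i) = i" "inv p (p i) = i" for i
      using p by (auto simp: bij_def surj_f_inv_f)
    have "(\<lambda>x. \<chi> i. x $ p i) -` box l u = box (?q l) (?q u)"
      by (auto simp: mem_box_cart) (metis pq)+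
    then have "emeasure (distr lborel borel (\<lambda>x. \<chi> i. x $ p i)) (box l u)
        = emeasure lborel (box (?q l) (?q u))"
      using m by (simp add: emeasure_distr)
    also have "\<dots> = ennreal (\<Prod>b\<in>Basis. (?q u - ?q l) \<bullet> b)"
      by (rule emeasure_lborel_box) (auto simp: Basis_vec_def inner_axis le')
    also have "(\<Prod>b\<in>Basis. (?q u - ?q l) \<bullet> b) = (\<Prod>i\<in>UNIV. (u - l) $ inv p i)"
      by (simp add: prod_Basis_cart inner_axis)
    also have "\<dots> = (\<Prod>i\<in>UNIV. (u - l) $ i)"
      using p by (intro prod.reindex_bij_betw bij_imp_bij_inv)
    also have "\<dots> = (\<Prod>b\<in>Basis. (u - l) \<bullet> b)"
      by (simp add: prod_Basis_cart inner_axis)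
    finally show "emeasure (distr lborel borel (\<lambda>x. \<chi> i. x $ p i)) (box l u)
      = ennreal (\<Prod>b\<in>Basis. (u - l) \<bullet> b)" .
  qed simp
  then show ?thesis
    using nn_integral_distr[of "\<lambda>x. \<chi> i. x $ p i" lborel borel h] h m by simp
qed

text \<open>
  For fixed values of the other coordinates, a shear translates the coordinate \<open>m\<close> by a
  constant, so after integrating \<open>m\<close> first this is translation invariance on the line.
\<close>
lemma nn_integral_shear:
  fixes h :: "real^'n \<Rightarrow> ennreal"
  assumes h: "h \<in> borel_measurable borel" and "m \<noteq> n"
  shows "(\<integral>\<^sup>+x. h x \<partial>lborel) = (\<integral>\<^sup>+x. h (\<chi> i. if i = m then x $ m + c * x $ n else x $ i) \<partial>lborel)"
proof -
  let ?s = "\<lambda>x::real^'n. \<chi> i. if i = m then x $ m + c * x $ n else x $ i"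
  have s: "?s \<in> borel_measurable borel"
    by (rule borel_measurable_vec_lambda) simp
  have mk: "(\<lambda>t. \<chi> i. if i = m then t else x i) \<in> borel_measurable borel" for x :: "'n \<Rightarrow> real"
    by (rule borel_measurable_vec_lambda) simp
  have "(\<integral>\<^sup>+t. h (\<chi> i. if i = m then t else x i) \<partial>lborel)
      = (\<integral>\<^sup>+t. h (?s (\<chi> i. if i = m then t else x i)) \<partial>lborel)" for x
  proof -
    have "(\<integral>\<^sup>+t. h (\<chi> i. if i = m then t else x i) \<partial>lborel)
        = (\<integral>\<^sup>+t. h (\<chi> i. if i = m then c * x n + 1 * t else x i) \<partial>lborel)"
      using nn_integral_real_affine[OF measurable_compose[OF mk h], of 1 x "c * x n"] by simp
    also have "\<dots> = (\<integral>\<^sup>+t. h (?s (\<chi> i. if i = m then t else x i)) \<partial>lborel)"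
      using \<open>m \<noteq> n\<close> by (intro nn_integral_cong arg_cong[where f=h]) (auto simp: vec_eq_iff)
    finally show ?thesis .
  qed
  then show ?thesis
    by (simp add: nn_integral_lborel_vec_split(1)[OF h, of m]
        nn_integral_lborel_vec_split(1)[OF measurable_compose[OF s h], of m])
qed

text \<open>
  The formula is compatible with products of matrices, so it suffices to treat the factors of a
  decomposition into elementary matrices: diagonal matrices scale the axes, transpositions
  permute the factors of the product measure, and shears preserve volume by Fubini. Matrices
  with a zero row only occur in products that are not invertible, which is why invertibility is
  part of the induction predicate.
\<close>
lemma nn_integral_matrix_substitution:
  fixes A :: "real^'n^'n" and h :: "real^'n \<Rightarrow> ennreal"
  assumes "h \<in> borel_measurable borel" and "invertible A"
  shows "(\<integral>\<^sup>+x. h x \<partial>lborel) = ennreal \<bar>det A\<bar> * (\<integral>\<^sup>+x. h (A *v x) \<partial>lborel)"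
proof -
  let ?P = "\<lambda>A::real^'n^'n. \<forall>h::real^'n \<Rightarrow> ennreal. h \<in> borel_measurable borel \<longrightarrow> invertible A \<longrightarrow>
    (\<integral>\<^sup>+x. h x \<partial>lborel) = ennreal \<bar>det A\<bar> * (\<integral>\<^sup>+x. h (A *v x) \<partial>lborel)"
  have "?P A"
  proof (rule induct_matrix_elementary[of ?P]; intro allI impI)
    fix A B :: "real^'n^'n" and h :: "real^'n \<Rightarrow> ennreal"
    assume A: "?P A" and B: "?P B" and h: "h \<in> borel_measurable borel" and AB: "invertible (A ** B)"
    then have inv: "invertible A" "invertible B"
      by (auto simp: invertible_det_nz det_mul)
    have "(\<integral>\<^sup>+x. h x \<partial>lborel) = ennreal \<bar>det A\<bar> * (\<integral>\<^sup>+x. h (A *v x) \<partial>lborel)"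
      using A h inv by blast
    also have "(\<integral>\<^sup>+x. h (A *v x) \<partial>lborel) = ennreal \<bar>det B\<bar> * (\<integral>\<^sup>+x. h (A *v (B *v x)) \<partial>lborel)"
      using B inv measurable_compose[OF borel_measurable_matrix_vector_mult[of A] h] by blast
    finally show "(\<integral>\<^sup>+x. h x \<partial>lborel) = ennreal \<bar>det (A ** B)\<bar> * (\<integral>\<^sup>+x. h (A ** B *v x) \<partial>lborel)"
      by (simp add: det_mul abs_mult ennreal_mult mult.assoc matrix_vector_mul_assoc)
  next
    fix A :: "real^'n^'n" and i and h :: "real^'n \<Rightarrow> ennreal"
    assume "row i A = 0" "invertible A"
    then show "(\<integral>\<^sup>+x. h x \<partial>lborel) = ennreal \<bar>det A\<bar> * (\<integral>\<^sup>+x. h (A *v x) \<partial>lborel)"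
      by (simp add: invertible_det_nz det_zero_row)
  next
    fix A :: "real^'n^'n" and h :: "real^'n \<Rightarrow> ennreal"
    assume "h \<in> borel_measurable borel" "\<And>i j. i \<noteq> j \<Longrightarrow> A $ i $ j = 0" "invertible A"
    then show "(\<integral>\<^sup>+x. h x \<partial>lborel) = ennreal \<bar>det A\<bar> * (\<integral>\<^sup>+x. h (A *v x) \<partial>lborel)"
      by (rule nn_integral_diagonal)
  next
    fix m n :: 'n and h :: "real^'n \<Rightarrow> ennreal"
    assume h: "h \<in> borel_measurable borel" and "m \<noteq> n"
    let ?p = "Transposition.transpose m n"
    let ?A = "(\<chi> i j. mat 1 $ i $ ?p j) :: real^'n^'n"
    have p: "?p permutes UNIV" by (rule permutes_swap_id) auto
    have "det ?A = of_int (sign ?p) * det (mat 1 :: real^'n^'n)"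
      using p by (rule det_permute_columns)
    then have "\<bar>det ?A\<bar> = 1" by (simp add: sign_def)
    moreover have "?A *v x = (\<chi> i. x $ ?p i)" for x
    proof -
      have "(mat 1 $ i $ ?p j :: real) = (if j = ?p i then 1 else 0)" for i j
        by (auto simp: mat_def)
      then show ?thesis
        by (simp add: vec_eq_iff matrix_vector_mult_def if_distrib[of "\<lambda>c. c * _"] cong: if_cong)
    qed
    moreover have "(\<integral>\<^sup>+x. h x \<partial>lborel) = (\<integral>\<^sup>+x. h (\<chi> i. x $ ?p i) \<partial>lborel)"
      using h by (rule nn_integral_permute_coordinates) simp
    ultimately show "(\<integral>\<^sup>+x. h x \<partial>lborel) = ennreal \<bar>det ?A\<bar> * (\<integral>\<^sup>+x. h (?A *v x) \<partial>lborel)"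
      by simp
  next
    fix m n :: 'n and c :: real and h :: "real^'n \<Rightarrow> ennreal"
    assume h: "h \<in> borel_measurable borel" and "m \<noteq> n"
    let ?A = "(\<chi> i j. if i = m \<and> j = n then c else of_bool (i = j)) :: real^'n^'n"
    have "det (\<chi> k. if k = m then row m (mat 1) + c *s row n (mat 1) else row k (mat 1)) = det (mat 1 :: real^'n^'n)"
      using \<open>m \<noteq> n\<close> by (rule det_row_operation)
    also have "(\<chi> k. if k = m then row m (mat 1) + c *s row n (mat 1) else row k (mat 1)) = ?A"
      using \<open>m \<noteq> n\<close> by (auto simp: vec_eq_iff row_def mat_def)
    finally have "det ?A = 1" by simp
    moreover have "?A *v x = (\<chi> i. if i = m then x $ m + c * x $ n else x $ i)" for x
    proof -
      have "(\<Sum>j\<in>UNIV. ?A $ i $ j * x $ j) = (if i = m then x $ m + c * x $ n else x $ i)" for i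
      proof -
        have "?A $ i $ j * x $ j = (if j = i then x $ j else 0) + (if j = n then (if i = m then c * x $ j else 0) else 0)" for j
          using \<open>m \<noteq> n\<close> by auto
        then show ?thesis by (simp add: sum.distrib)
      qed
      then show ?thesis
        by (simp add: vec_eq_iff matrix_vector_mult_def)
    qed
    ultimately show "(\<integral>\<^sup>+x. h x \<partial>lborel) = ennreal \<bar>det ?A\<bar> * (\<integral>\<^sup>+x. h (?A *v x) \<partial>lborel)"
      using nn_integral_shear[OF h \<open>m \<noteq> n\<close>, of c] by simp
  qed
  with assms show ?thesis by blast
qed

section \<open>Whitening a positive definite form\<close>

lemma sym_pos_def_inner_commute:
  assumes "sym_pos_def A"
  shows "(x v* A) \<bullet> y = (y v* A) \<bullet> x"
proof -
  have "(x v* A) \<bullet> y = x \<bullet> (transpose A *v y)"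
    using assms by (simp add: dot_lmul_matrix sym_pos_def_def)
  then show ?thesis by (simp add: inner_commute)
qed

lemma sym_pos_def_pos: "sym_pos_def A \<Longrightarrow> x \<noteq> 0 \<Longrightarrow> 0 < (x v* A) \<bullet> x"
  by (simp add: sym_pos_def_def)

lemma scaleR_quadratic_form:
  fixes A :: "real^'n^'n"
  shows "((c *\<^sub>R x) v* A) \<bullet> (c *\<^sub>R x) = c\<^sup>2 * ((x v* A) \<bullet> x)"
  by (simp add: dot_lmul_matrix matrix_vector_mult_scaleR power2_eq_square)

lemma sym_pos_def_invertible:
  assumes "sym_pos_def A" shows "invertible A"
proof -
  have "x = 0" if "A *v x = 0" for x
    using sym_pos_def_pos[OF assms, of x] that by (auto simp: dot_lmul_matrix)
  then have "inj ((*v) A)"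
    by (metis matrix_left_invertible_ker matrix_left_invertible_injective)
  then show ?thesis
    by (metis invertible_left_inverse matrix_left_invertible_injective)
qed

text \<open>
  Gram-Schmidt for the inner product \<open>\<lambda>x y. (x v* A) \<bullet> y\<close>, begun at the unit vector \<open>w\<close>. The
  family is extended index by index: as long as an index is missing, the vectors found so far
  cannot span the space.
\<close>
lemma sym_pos_def_orthonormal_family:
  fixes A :: "real^'n^'n" and k :: 'n
  assumes A: "sym_pos_def A" and w: "(w v* A) \<bullet> w = 1"
  obtains b :: "'n \<Rightarrow> real^'n"
  where "\<And>i j. (b i v* A) \<bullet> b j = (if i = j then 1 else 0)" "b k = w"
proof -
  let ?B = "\<lambda>x y. (x v* A) \<bullet> y"
  have ext: "\<exists>b. (\<forall>i\<in>insert k K. \<forall>j\<in>insert k K. ?B (b i) (b j) = (if i = j then 1 else 0)) \<and> b k = w"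
    if "finite K" for K :: "'n set"
    using that
  proof (induction K rule: finite_induct)
    case empty
    show ?case by (rule exI[of _ "\<lambda>_. w"]) (simp add: w)
  next
    case (insert l K)
    then obtain b where orth: "\<And>i j. i \<in> insert k K \<Longrightarrow> j \<in> insert k K \<Longrightarrow> ?B (b i) (b j) = (if i = j then 1 else 0)"
      and bk: "b k = w" by metis
    show ?case
    proof (cases "l = k")
      case True
      with orth bk show ?thesis by (intro exI[of _ b]) auto
    next
      case False
      let ?K = "insert k K"
      have lK: "l \<notin> ?K" using insert False by auto
      then have "card ?K < CARD('n)"
        by (intro psubset_card_mono) auto
      moreover have "dim (b ` ?K) \<le> card ?K"
        by (meson card_image_le dim_le_card' finite finite_imageI le_trans)
      ultimately have "dim (b ` ?K) < dim (UNIV :: (real^'n) set)"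
        by simp
      then have "span (b ` ?K) \<noteq> UNIV"
        by (metis dim_span less_irrefl)
      then obtain u where u: "u \<notin> span (b ` ?K)" by auto
      define u' where "u' = u - (\<Sum>i\<in>?K. ?B (b i) u *\<^sub>R b i)"
      have "(\<Sum>i\<in>?K. ?B (b i) u *\<^sub>R b i) \<in> span (b ` ?K)"
        by (intro span_sum span_scale span_base) auto
      with u have "u' \<noteq> 0" by (auto simp: u'_def)
      then have pos: "?B u' u' > 0" using A by (rule sym_pos_def_pos[rotated])
      have bu': "?B (b j) u' = 0" if "j \<in> ?K" for j
      proof -
        have "?B (b j) u' = ?B (b j) u - (\<Sum>i\<in>?K. ?B (b i) u * ?B (b j) (b i))"
          by (simp add: u'_def inner_diff_right inner_sum_right)
        also have "(\<Sum>i\<in>?K. ?B (b i) u * ?B (b j) (b i)) = (\<Sum>i\<in>?K. if i = j then ?B (b i) u else 0)"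
          using that orth by (intro sum.cong) auto
        also have "\<dots> = ?B (b j) u"
          using that by simp
        finally show ?thesis by simp
      qed
      define v where "v = (1 / sqrt (?B u' u')) *\<^sub>R u'"
      have vv: "?B v v = 1"
        unfolding v_def scaleR_quadratic_form using pos by (simp add: power_divide)
      have bv: "?B (b j) v = 0" "?B v (b j) = 0" if "j \<in> ?K" for j
        using bu'[OF that] sym_pos_def_inner_commute[OF A, of v "b j"] by (simp_all add: v_def)
      show ?thesis
      proof (intro exI[of _ "b(l := v)"] conjI ballI)
        show "(b(l := v)) k = w" using False bk by simp
        fix i j assume "i \<in> insert k (insert l K)" "j \<in> insert k (insert l K)"
        then have "i = l \<or> i \<in> ?K" "j = l \<or> j \<in> ?K" by auto
        then show "?B ((b(l := v)) i) ((b(l := v)) j) = (if i = j then 1 else 0)"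
          using lK vv bv orth by (auto simp: fun_upd_def)
      qed
    qed
  qed
  from ext[of UNIV] that show ?thesis by auto
qed

text \<open>
  The substitution \<open>x = T z\<close> must turn the ellipsoids of \<open>matrix_inv A\<close> into round spheres and
  at the same time turn the functional \<open>\<lambda>x. \<delta> \<bullet> x\<close> into a multiple of one coordinate. If \<open>R\<close> has
  \<open>A\<close>-orthonormal rows, that is \<open>R ** A ** transpose R = mat 1\<close>, then \<open>T = A ** transpose R\<close> is
  inverse to \<open>R\<close> and does the first; it does the second if row \<open>k\<close> of \<open>R\<close> is \<open>\<delta>\<close> normalised with
  respect to \<open>A\<close>.
\<close>
lemma sym_pos_def_whitening:
  fixes A :: "real^'n^'n"
  assumes A: "sym_pos_def A" and "\<delta> \<noteq> 0"
  obtains T :: "real^'n^'n" where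
    "invertible T" "\<bar>det T\<bar> = sqrt (det A)" "0 < det A"
    "\<And>z. ((T *v z) v* matrix_inv A) \<bullet> (T *v z) = z \<bullet> z"
    "\<And>z. \<delta> \<bullet> (T *v z) = sqrt ((\<delta> v* A) \<bullet> \<delta>) * z $ k"
proof -
  let ?B = "\<lambda>x y. (x v* A) \<bullet> y"
  let ?\<sigma> = "sqrt (?B \<delta> \<delta>)"
  have pos: "?B \<delta> \<delta> > 0"
    using A \<open>\<delta> \<noteq> 0\<close> by (rule sym_pos_def_pos)
  define w where "w = (1 / ?\<sigma>) *\<^sub>R \<delta>"
  have "?B w w = 1"
    unfolding w_def scaleR_quadratic_form using pos by (simp add: power_divide)
  then obtain b where orth: "\<And>i j. ?B (b i) (b j) = (if i = j then 1 else 0)" and bk: "b k = w"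
    using sym_pos_def_orthonormal_family[OF A] by metis
  define R :: "real^'n^'n" where "R = (\<chi> i. b i)"
  have RAR: "R ** A ** transpose R = mat 1"
  proof -
    have "(R ** A ** transpose R) $ i $ j = ?B (b i) (b j)" for i j
      by (simp add: R_def matrix_matrix_mult_def transpose_def vector_matrix_mult_def inner_vec_def ac_simps)
    then show ?thesis by (simp add: vec_eq_iff orth mat_def)
  qed
  define T where "T = A ** transpose R"
  have RT: "R ** T = mat 1"
    using RAR by (simp add: T_def matrix_mul_assoc)
  then have "invertible T"
    using invertible_left_inverse by blast
  have detA: "det R * det A * det R = 1"
    using RAR by (metis det_I det_mul det_transpose)
  then have "det A = (1 / det R)\<^sup>2"
    by (simp add: power2_eq_square divide_simps) (metis mult.assoc mult.commute mult_eq_0_iff zero_neq_one)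
  moreover have "det R \<noteq> 0" using detA by auto
  moreover have "det T = 1 / det R"
    using RT \<open>det R \<noteq> 0\<close> by (metis det_I det_mul nonzero_eq_divide_eq mult.commute)
  ultimately have det: "\<bar>det T\<bar> = sqrt (det A)" "0 < det A"
    by simp_all
  have Ainv: "matrix_inv A ** A = mat 1"
    using someI_ex[OF sym_pos_def_invertible[OF A, unfolded invertible_def]]
    by (simp add: matrix_inv_def)
  have q: "((T *v z) v* matrix_inv A) \<bullet> (T *v z) = z \<bullet> z" for z
  proof -
    have "((T *v z) v* matrix_inv A) \<bullet> (T *v z) = (T *v z) \<bullet> (matrix_inv A *v (T *v z))"
      by (rule dot_lmul_matrix)
    also have "matrix_inv A *v (T *v z) = transpose R *v z"
      by (simp add: T_def matrix_vector_mul_assoc matrix_mul_assoc Ainv)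
    also have "(T *v z) \<bullet> (transpose R *v z) = (transpose R *v z) \<bullet> (T *v z)"
      by (rule inner_commute)
    also have "\<dots> = (z v* R) \<bullet> (T *v z)" by simp
    also have "\<dots> = z \<bullet> (R *v (T *v z))" by (rule dot_lmul_matrix)
    also have "\<dots> = z \<bullet> z" by (simp add: matrix_vector_mul_assoc RT)
    finally show ?thesis .
  qed
  have d: "\<delta> \<bullet> (T *v z) = ?\<sigma> * z $ k" for z
  proof -
    have "\<delta> = ?\<sigma> *\<^sub>R w" using pos by (simp add: w_def)
    also have "w = axis k 1 v* R"
      by (simp add: vec_eq_iff vector_matrix_mult_def axis_def R_def bk[symmetric] if_distribR if_distrib cong: if_cong)
    finally have "\<delta> \<bullet> (T *v z) = ?\<sigma> * ((axis k 1 v* R) \<bullet> (T *v z))"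
      by (metis inner_scaleR_left)
    also have "(axis k 1 v* R) \<bullet> (T *v z) = z $ k"
      by (simp add: dot_lmul_matrix matrix_vector_mul_assoc RT inner_axis')
    finally show ?thesis .
  qed
  show ?thesis by (rule that[OF \<open>invertible T\<close> det q d])
qed

section \<open>Polar coordinates for radial functions\<close>

text \<open>
  The surface area of the unit sphere in dimension \<open>d\<close>; for \<open>d = 1\<close> it is \<open>2\<close>, the number of
  points of the sphere on the line.
\<close>
definition sphere_area :: "nat \<Rightarrow> real" where
  "sphere_area d = 2 * pi powr (real d / 2) / Gamma (real d / 2)"

lemma sphere_area_pos: "0 < d \<Longrightarrow> 0 < sphere_area d"
  by (simp add: sphere_area_def Gamma_real_pos)

lemma sphere_area_eq: "0 < d \<Longrightarrow> sphere_area d = real d * unit_ball_vol (real d)"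
proof -
  assume d: "0 < d"
  then have "Gamma (real d / 2 + 1) = real d / 2 * Gamma (real d / 2)"
    by (intro Gamma_plus1) (auto dest: nonpos_Ints_nonpos)
  moreover have "Gamma (real d / 2) \<noteq> 0" using d by (intro less_imp_neq[symmetric] Gamma_real_pos) simp
  ultimately show ?thesis
    using d unfolding sphere_area_def unit_ball_vol_def
    by (simp del: times_divide_eq_left) (simp add: field_simps)
qed

text \<open>
  Polar coordinates for radial functions: the volume \<open>unit_ball_vol d * r ^ d\<close> of the balls
  determines the image of Lebesgue measure under the radius, and its derivative in \<open>r\<close> is
  \<open>sphere_area d * r ^ (d - 1)\<close>.
\<close>
lemma distr_radius_PiM:
  fixes I :: "'i set"
  assumes I: "finite I" "I \<noteq> {}"
  shows "distr (\<Pi>\<^sub>M i\<in>I. lborel) borel (\<lambda>x. sqrt (\<Sum>i\<in>I. (x i)\<^sup>2))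
    = density lborel (\<lambda>r. ennreal (sphere_area (card I) * r ^ (card I - 1) * indicator {0..} r))"
    (is "?L = ?R")
proof (rule measure_eqI_generator_eq)
  let ?E = "range (\<lambda>r::real. {..r})"
  let ?d = "card I"
  have d: "0 < ?d" using I by (simp add: card_gt_0_iff)
  interpret product_sigma_finite "\<lambda>_::'i. lborel :: real measure" by standard
  have m: "(\<lambda>x. sqrt (\<Sum>i\<in>I. (x i)\<^sup>2)) \<in> borel_measurable (\<Pi>\<^sub>M i\<in>I. lborel)"
    by measurable
  have L: "emeasure ?L {..r} = ennreal (unit_ball_vol (real ?d) * (max 0 r) ^ ?d)" for r
  proof -
    have eq: "emeasure ?L {..r} = emeasure (\<Pi>\<^sub>M i\<in>I. lborel)
        ({f. sqrt (\<Sum>i\<in>I. (f i)\<^sup>2) \<le> r} \<inter> space (\<Pi>\<^sub>M i\<in>I. lborel))"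
      by (subst emeasure_distr[OF m]) (auto intro!: arg_cong2[where f=emeasure])
    consider "r > 0" | "r = 0" | "r < 0" by linarith
    then show ?thesis
    proof cases
      case 1
      then show ?thesis using emeasure_cball_aux[OF I(1) 1] by (simp add: eq)
    next
      case 2
      have "{f. sqrt (\<Sum>i\<in>I. (f i)\<^sup>2) \<le> r} \<inter> space (\<Pi>\<^sub>M i\<in>I. lborel) = (\<Pi>\<^sub>E i\<in>I. {0})"
      proof (intro set_eqI)
        fix x :: "'i \<Rightarrow> real"
        have "(\<Sum>i\<in>I. (x i)\<^sup>2) \<le> 0 \<longleftrightarrow> (\<Sum>i\<in>I. (x i)\<^sup>2) = 0"
          using sum_nonneg[of I "\<lambda>i. (x i)\<^sup>2"] by auto
        also have "\<dots> \<longleftrightarrow> (\<forall>i\<in>I. x i = 0)"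
          using I(1) by (subst sum_nonneg_eq_0_iff) auto
        finally show "x \<in> {f. sqrt (\<Sum>i\<in>I. (f i)\<^sup>2) \<le> r} \<inter> space (\<Pi>\<^sub>M i\<in>I. lborel)
            \<longleftrightarrow> x \<in> (\<Pi>\<^sub>E i\<in>I. {0})"
          using 2 by (auto simp: space_PiM PiE_iff restrict_def extensional_def fun_eq_iff)
      qed
      then have "emeasure ?L {..r} = emeasure (\<Pi>\<^sub>M i\<in>I. lborel) (\<Pi>\<^sub>E i\<in>I. {0::real})"
        unfolding eq by (simp only:)
      also have "\<dots> = (\<Prod>i\<in>I. emeasure lborel {0::real})"
        using I(1) by (rule emeasure_PiM) simp
      finally have "emeasure ?L {..r} = (\<Prod>i\<in>I. emeasure lborel {0::real})" .
      then show ?thesis using 2 d I by (simp add: power_0_left)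
    next
      case 3
      moreover have "0 \<le> sqrt (\<Sum>i\<in>I. (f i)\<^sup>2)" for f :: "'i \<Rightarrow> real"
        by (simp add: sum_nonneg)
      ultimately have "{f. sqrt (\<Sum>i\<in>I. (f i)\<^sup>2) \<le> r} = {}"
        by (auto simp: not_le intro: less_le_trans)
      then show ?thesis using 3 d unfolding eq by (simp add: power_0_left)
    qed
  qed
  have R: "emeasure ?R {..r} = ennreal (unit_ball_vol (real ?d) * (max 0 r) ^ ?d)" for r
  proof -
    have "emeasure ?R {..r} = (\<integral>\<^sup>+t. ennreal (sphere_area ?d * t ^ (?d - 1) * indicator {0..} t) * indicator {..r} t \<partial>lborel)"
      by (rule emeasure_density) auto
    also have "\<dots> = (\<integral>\<^sup>+t. ennreal (sphere_area ?d * t ^ (?d - 1)) * indicator {0..max 0 r} t \<partial>lborel)"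
      \<comment> \<open>For \<open>r < 0\<close> the two integrands differ at \<open>t = 0\<close> when \<open>I\<close> is a singleton.\<close>
      by (rule nn_integral_cong_AE, rule AE_I[of _ _ "{0}"]) (auto simp: indicator_def)
    also have "\<dots> = ennreal (unit_ball_vol (real ?d) * (max 0 r) ^ ?d - unit_ball_vol (real ?d) * 0 ^ ?d)"
    proof (rule nn_integral_FTC_Icc)
      fix t :: real assume t: "t \<in> {0..max 0 r}"
      show "((\<lambda>x. unit_ball_vol (real ?d) * x ^ ?d) has_real_derivative sphere_area ?d * t ^ (?d - 1)) (at t)"
        using d by (auto intro!: derivative_eq_intros simp: sphere_area_eq)
      show "0 \<le> sphere_area ?d * t ^ (?d - 1)"
        using t sphere_area_pos[OF d] by simp
    qed auto
    finally show ?thesis using d by simp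
  qed
  show "Int_stable ?E" by (auto simp: Int_stable_def)
  show "?E \<subseteq> Pow UNIV" by simp
  show "sets ?L = sigma_sets UNIV ?E" "sets ?R = sigma_sets UNIV ?E"
    by (simp_all add: borel_eq_atMost)
  show "emeasure ?L X = emeasure ?R X" if "X \<in> ?E" for X
    using that L R by auto
  show "range (\<lambda>i::nat. {..real i}) \<subseteq> ?E" by auto
  show "(\<Union>i::nat. {..real i}) = UNIV"
    by (auto intro: real_arch_simple)
  show "emeasure ?L {..real i} \<noteq> \<infinity>" for i :: nat
    using L by simp
qed

lemma nn_integral_radial_PiM:
  fixes h :: "real \<Rightarrow> ennreal"
  assumes I: "finite I" "I \<noteq> {}" and h: "h \<in> borel_measurable borel"
  shows "(\<integral>\<^sup>+x. h (\<Sum>i\<in>I. (x i)\<^sup>2) \<partial>(\<Pi>\<^sub>M i\<in>I. lborel))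
    = ennreal (sphere_area (card I)) * (\<integral>\<^sup>+r. ennreal (r ^ (card I - 1)) * h (r\<^sup>2) * indicator {0..} r \<partial>lborel)"
proof -
  have d: "0 < card I" using I by (simp add: card_gt_0_iff)
  have h2: "(\<lambda>r::real. h (r\<^sup>2)) \<in> borel_measurable borel"
    using h by measurable
  have "(\<integral>\<^sup>+x. h (\<Sum>i\<in>I. (x i)\<^sup>2) \<partial>(\<Pi>\<^sub>M i\<in>I. lborel))
      = (\<integral>\<^sup>+x. h ((sqrt (\<Sum>i\<in>I. (x i)\<^sup>2))\<^sup>2) \<partial>(\<Pi>\<^sub>M i\<in>I. lborel))"
    by (simp add: sum_nonneg)
  also have "\<dots> = (\<integral>\<^sup>+r. h (r\<^sup>2) \<partial>distr (\<Pi>\<^sub>M i\<in>I. lborel) borel (\<lambda>x. sqrt (\<Sum>i\<in>I. (x i)\<^sup>2)))"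
    using h2 by (subst nn_integral_distr) auto
  also have "\<dots> = (\<integral>\<^sup>+r. ennreal (sphere_area (card I) * r ^ (card I - 1) * indicator {0..} r) * h (r\<^sup>2) \<partial>lborel)"
    unfolding distr_radius_PiM[OF I] using h2 by (subst nn_integral_density) auto
  also have "\<dots> = (\<integral>\<^sup>+r. ennreal (sphere_area (card I)) * (ennreal (r ^ (card I - 1)) * h (r\<^sup>2) * indicator {0..} r) \<partial>lborel)"
    using sphere_area_pos[OF d]
    by (intro nn_integral_cong) (auto simp: indicator_def ennreal_mult mult_ac)
  also have "\<dots> = ennreal (sphere_area (card I)) * (\<integral>\<^sup>+r. ennreal (r ^ (card I - 1)) * h (r\<^sup>2) * indicator {0..} r \<partial>lborel)"
    using h2 by (intro nn_integral_cmult) auto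
  finally show ?thesis .
qed

section \<open>One-dimensional projections of elliptic densities\<close>

text \<open>
  The density of one coordinate of a vector in dimension \<open>n\<close> with density \<open>\<lambda>x. g (x \<bullet> x)\<close>. It
  takes extended values because for \<open>n = 2\<close> the integral can diverge at individual points \<open>z\<close>.
\<close>
definition radial_marginal :: "nat \<Rightarrow> (real \<Rightarrow> real) \<Rightarrow> real \<Rightarrow> ennreal" where
  "radial_marginal n g z = ennreal (sphere_area (n - 1)) *
     (\<integral>\<^sup>+r. ennreal (r ^ (n - 2) * g (z\<^sup>2 + r\<^sup>2)) * indicator {0..} r \<partial>lborel)"

text \<open>
  The values of \<open>g\<close> on the negative axis are arbitrary, but \<open>z\<^sup>2 + r\<^sup>2\<close> never leaves the
  half-line.
\<close>
lemma measurable_radial_generator: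
  fixes g :: "real \<Rightarrow> real"
  assumes "set_borel_measurable borel {0..} g"
  shows "(\<lambda>(z, r). g (z\<^sup>2 + r\<^sup>2)) \<in> borel_measurable (borel \<Otimes>\<^sub>M borel)"
proof -
  have [measurable]: "(\<lambda>s. indicator {0..} s * g s) \<in> borel_measurable borel"
    using assms by (simp add: set_borel_measurable_def)
  have "(\<lambda>(z, r). g (z\<^sup>2 + r\<^sup>2)) = (\<lambda>(z, r). indicator {0..} (z\<^sup>2 + r\<^sup>2) * g (z\<^sup>2 + r\<^sup>2))"
    by (auto simp: indicator_def)
  also have "\<dots> \<in> borel_measurable (borel \<Otimes>\<^sub>M borel)"
    by measurable
  finally show ?thesis .
qed

lemma borel_measurable_radial_marginal:
  assumes "set_borel_measurable borel {0..} g"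
  shows "radial_marginal n g \<in> borel_measurable borel"
proof -
  note [measurable] = measurable_radial_generator[OF assms]
  have [measurable]: "(\<lambda>(z, r). g (z\<^sup>2 + r\<^sup>2)) \<in> borel_measurable (borel \<Otimes>\<^sub>M lborel)"
    using measurable_radial_generator[OF assms] by simp
  show ?thesis
    unfolding radial_marginal_def[abs_def] by measurable
qed

text \<open>
  Where the inner integral diverges, the Bochner integral in \<open>elliptic_tail\<close> is \<open>0\<close> instead of
  infinite. Finiteness of the total mass confines this to a null set.
\<close>
lemma elliptic_tail_eq_nn_integral:
  assumes n: "2 \<le> n" and g: "set_borel_measurable borel {0..} g" and g0: "\<And>s. 0 \<le> s \<Longrightarrow> 0 \<le> g s"
    and fin: "(\<integral>\<^sup>+z. radial_marginal n g z \<partial>lborel) < \<infinity>"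
  shows "ennreal (elliptic_tail n g s) = (\<integral>\<^sup>+z. radial_marginal n g z * indicator {..- s} z \<partial>lborel)"
    and "0 \<le> elliptic_tail n g s"
proof -
  define J where "J z = (\<integral>\<^sup>+r. ennreal (r ^ (n - 2) * g (z\<^sup>2 + r\<^sup>2)) * indicator {0..} r \<partial>lborel)" for z
  let ?C = "sphere_area (n - 1)"
  have C: "0 < ?C" using n by (intro sphere_area_pos) simp
  have mg [measurable]: "(\<lambda>(z, r). g (z\<^sup>2 + r\<^sup>2)) \<in> borel_measurable (borel \<Otimes>\<^sub>M lborel)"
    using measurable_radial_generator[OF g] by simp
  have J [measurable]: "J \<in> borel_measurable borel"
    unfolding J_def[abs_def] by measurable
  have mar: "radial_marginal n g z = ennreal ?C * J z" for z
    by (simp add: radial_marginal_def J_def)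
  have "(\<integral>\<^sup>+z. radial_marginal n g z \<partial>lborel) = ennreal ?C * (\<integral>\<^sup>+z. J z \<partial>lborel)"
    unfolding mar using J by (intro nn_integral_cmult) simp
  with fin C have finJ: "(\<integral>\<^sup>+z. J z \<partial>lborel) < \<infinity>"
    by (auto simp: ennreal_mult_less_top)
  then have AE_J: "AE z in lborel. J z \<noteq> \<infinity>"
    using J by (intro nn_integral_PInf_AE) auto
  have inner: "(LBINT r:{0..}. r ^ (n - 2) * g (z\<^sup>2 + r\<^sup>2)) = enn2real (J z)" for z
  proof -
    have [measurable]: "(\<lambda>r. g (z\<^sup>2 + r\<^sup>2)) \<in> borel_measurable borel"
      using measurable_compose[OF _ measurable_radial_generator[OF g], of "\<lambda>r. (z, r)" borel] by simp
    have "(LBINT r:{0..}. r ^ (n - 2) * g (z\<^sup>2 + r\<^sup>2))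
        = enn2real (\<integral>\<^sup>+r. ennreal (indicator {0..} r *\<^sub>R (r ^ (n - 2) * g (z\<^sup>2 + r\<^sup>2))) \<partial>lborel)"
      unfolding set_lebesgue_integral_def
      by (intro integral_eq_nn_integral) (auto simp: indicator_def g0)
    also have "\<dots> = enn2real (J z)"
      unfolding J_def
      by (intro arg_cong[where f=enn2real] nn_integral_cong) (auto simp: indicator_def)
    finally show ?thesis .
  qed
  have "(LBINT z:{..- s}. LBINT r:{0..}. r ^ (n - 2) * g (z\<^sup>2 + r\<^sup>2))
      = enn2real (\<integral>\<^sup>+z. ennreal (indicator {..- s} z *\<^sub>R enn2real (J z)) \<partial>lborel)"
    unfolding inner unfolding set_lebesgue_integral_def
    by (intro integral_eq_nn_integral) (auto simp: indicator_def)
  also have "(\<integral>\<^sup>+z. ennreal (indicator {..- s} z *\<^sub>R enn2real (J z)) \<partial>lborel)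
      = (\<integral>\<^sup>+z. J z * indicator {..- s} z \<partial>lborel)"
    by (rule nn_integral_cong_AE) (use AE_J in \<open>eventually_elim, auto simp: indicator_def less_top\<close>)
  finally have outer: "(LBINT z:{..- s}. LBINT r:{0..}. r ^ (n - 2) * g (z\<^sup>2 + r\<^sup>2))
      = enn2real (\<integral>\<^sup>+z. J z * indicator {..- s} z \<partial>lborel)" .
  have "(\<integral>\<^sup>+z. J z * indicator {..- s} z \<partial>lborel) \<le> (\<integral>\<^sup>+z. J z \<partial>lborel)"
    by (intro nn_integral_mono) (auto simp: indicator_def)
  with finJ have finI: "(\<integral>\<^sup>+z. J z * indicator {..- s} z \<partial>lborel) < \<infinity>"
    by auto
  have tail: "elliptic_tail n g s = ?C * enn2real (\<integral>\<^sup>+z. J z * indicator {..- s} z \<partial>lborel)"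
    using n by (simp add: elliptic_tail_def outer sphere_area_def of_nat_diff)
  show "0 \<le> elliptic_tail n g s" unfolding tail using C by simp
  have "(\<integral>\<^sup>+z. radial_marginal n g z * indicator {..- s} z \<partial>lborel)
      = ennreal ?C * (\<integral>\<^sup>+z. J z * indicator {..- s} z \<partial>lborel)"
    unfolding mar mult.assoc using J by (intro nn_integral_cmult) simp
  also have "\<dots> = ennreal (elliptic_tail n g s)"
    unfolding tail using C finI by (simp add: ennreal_mult)
  finally show "ennreal (elliptic_tail n g s) = (\<integral>\<^sup>+z. radial_marginal n g z * indicator {..- s} z \<partial>lborel)" ..
qed

text \<open>
  The law of \<open>\<delta> \<bullet> X\<close> for elliptic \<open>X\<close>. Translation by \<open>\<mu>\<close> and whitening make the density radial
  and \<open>\<delta> \<bullet> x\<close> an affine function of the coordinate \<open>k\<close>; the factor \<open>\<bar>det T\<bar>\<close> cancels the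
  normalisation of the density; polar coordinates in the remaining coordinates give the
  marginal.
\<close>
lemma elliptic_density_projection:
  fixes A :: "real^'n^'n" and \<phi> :: "real \<Rightarrow> ennreal"
  assumes n: "2 \<le> CARD('n)" and A: "sym_pos_def A" and \<delta>: "\<delta> \<noteq> 0"
    and g: "set_borel_measurable borel {0..} g" and g0: "\<And>s. 0 \<le> s \<Longrightarrow> 0 \<le> g s"
    and f: "elliptic_density \<mu> A g \<in> borel_measurable borel"
    and \<phi> [measurable]: "\<phi> \<in> borel_measurable borel"
  shows "(\<integral>\<^sup>+x. ennreal (elliptic_density \<mu> A g x) * \<phi> (\<delta> \<bullet> x) \<partial>lborel)
    = (\<integral>\<^sup>+z. radial_marginal CARD('n) g z * \<phi> (\<delta> \<bullet> \<mu> + sqrt ((\<delta> v* A) \<bullet> \<delta>) * z) \<partial>lborel)"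
proof -
  \<comment> \<open>Which coordinate carries the direction \<open>\<delta>\<close> is irrelevant.\<close>
  obtain k :: 'n where True by simp
  obtain T :: "real^'n^'n" where T: "invertible T" "\<bar>det T\<bar> = sqrt (det A)" "0 < det A"
    and q: "\<And>z. ((T *v z) v* matrix_inv A) \<bullet> (T *v z) = z \<bullet> z"
    and d: "\<And>z. \<delta> \<bullet> (T *v z) = sqrt ((\<delta> v* A) \<bullet> \<delta>) * z $ k"
    using sym_pos_def_whitening[OF A \<delta>, of k] by metis
  let ?\<sigma> = "sqrt ((\<delta> v* A) \<bullet> \<delta>)"
  define G where "G s = ennreal (indicator {0..} s * g s)" for s
  have G [measurable]: "G \<in> borel_measurable borel"
    using g by (simp add: G_def[abs_def] set_borel_measurable_def)
  have Geq: "G s = ennreal (g s)" if "0 \<le> s" for s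
    using that by (simp add: G_def)
  define h where "h x = ennreal (elliptic_density \<mu> A g x) * \<phi> (\<delta> \<bullet> x)" for x
  note f [measurable]
  have h: "h \<in> borel_measurable borel"
    unfolding h_def[abs_def] by measurable
  have h': "(\<lambda>x. h (\<mu> + x)) \<in> borel_measurable borel"
    using h by measurable
  have [measurable]: "(\<lambda>z::real^'n. z $ k) \<in> borel_measurable borel"
    by measurable
  have det1: "sqrt (det A) * det A powr (- 1 / 2) = 1"
    using T(3) by (simp add: powr_half_sqrt[symmetric] powr_add[symmetric])
  have "(\<integral>\<^sup>+x. h x \<partial>lborel) = (\<integral>\<^sup>+x. h x \<partial>distr lborel borel ((+) \<mu>))"
    by (simp add: lborel_distr_plus)
  also have "\<dots> = (\<integral>\<^sup>+x. h (\<mu> + x) \<partial>lborel)"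
    using h by (intro nn_integral_distr) auto
  also have "\<dots> = ennreal \<bar>det T\<bar> * (\<integral>\<^sup>+z. h (\<mu> + T *v z) \<partial>lborel)"
    using h' T(1) by (rule nn_integral_matrix_substitution)
  also have "\<dots> = ennreal \<bar>det T\<bar> * (\<integral>\<^sup>+z. ennreal (det A powr (- 1 / 2)) * (G (z \<bullet> z) * \<phi> (\<delta> \<bullet> \<mu> + ?\<sigma> * z $ k)) \<partial>lborel)"
    by (intro arg_cong2[where f="(*)"] nn_integral_cong refl)
       (simp add: h_def elliptic_density_def q d inner_add_right Geq g0 ennreal_mult mult.assoc)
  also have "\<dots> = ennreal (\<bar>det T\<bar> * det A powr (- 1 / 2)) * (\<integral>\<^sup>+z. G (z \<bullet> z) * \<phi> (\<delta> \<bullet> \<mu> + ?\<sigma> * z $ k) \<partial>lborel)"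
    by (subst nn_integral_cmult) (auto simp: ennreal_mult mult.assoc)
  also have "\<dots> = (\<integral>\<^sup>+z. G (z \<bullet> z) * \<phi> (\<delta> \<bullet> \<mu> + ?\<sigma> * z $ k) \<partial>lborel)"
    unfolding T(2) det1 by simp
  also have "\<dots> = (\<integral>\<^sup>+t. \<integral>\<^sup>+x. G (t\<^sup>2 + (\<Sum>i\<in>UNIV - {k}. (x i)\<^sup>2)) * \<phi> (\<delta> \<bullet> \<mu> + ?\<sigma> * t)
      \<partial>(\<Pi>\<^sub>M i\<in>UNIV - {k}. lborel) \<partial>lborel)"
  proof (subst nn_integral_lborel_vec_split(2)[where k=k])
    show "(\<lambda>z::real^'n. G (z \<bullet> z) * \<phi> (\<delta> \<bullet> \<mu> + ?\<sigma> * z $ k)) \<in> borel_measurable borel"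
      by measurable
    have "(\<chi> i. if i = k then t else x i) \<bullet> (\<chi> i. if i = k then t else x i)
        = t\<^sup>2 + (\<Sum>i\<in>UNIV - {k}. (x i)\<^sup>2)" for t :: real and x :: "'n \<Rightarrow> real"
      by (simp add: inner_vec_def sum.remove[of UNIV k] power2_eq_square)
    then show "(\<integral>\<^sup>+t. \<integral>\<^sup>+x. G ((\<chi> i. if i = k then t else x i) \<bullet> (\<chi> i. if i = k then t else x i))
          * \<phi> (\<delta> \<bullet> \<mu> + ?\<sigma> * (\<chi> i. if i = k then t else x i) $ k) \<partial>(\<Pi>\<^sub>M i\<in>UNIV - {k}. lborel) \<partial>lborel)
      = (\<integral>\<^sup>+t. \<integral>\<^sup>+x. G (t\<^sup>2 + (\<Sum>i\<in>UNIV - {k}. (x i)\<^sup>2)) * \<phi> (\<delta> \<bullet> \<mu> + ?\<sigma> * t)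
          \<partial>(\<Pi>\<^sub>M i\<in>UNIV - {k}. lborel) \<partial>lborel)"
      by simp
  qed
  also have "\<dots> = (\<integral>\<^sup>+t. radial_marginal CARD('n) g t * \<phi> (\<delta> \<bullet> \<mu> + ?\<sigma> * t) \<partial>lborel)"
  proof (intro nn_integral_cong)
    fix t :: real
    have card: "card (UNIV - {k}) = CARD('n) - 1"
      by (simp add: card_Diff_singleton)
    have ne: "UNIV - {k} \<noteq> {}"
      using n card by (metis card.empty diff_is_0_eq not_less_eq_eq numeral_2_eq_2 One_nat_def)
    have "(\<integral>\<^sup>+x. G (t\<^sup>2 + (\<Sum>i\<in>UNIV - {k}. (x i)\<^sup>2)) \<partial>(\<Pi>\<^sub>M i\<in>UNIV - {k}. lborel))
        = ennreal (sphere_area (CARD('n) - 1)) *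
          (\<integral>\<^sup>+r. ennreal (r ^ (CARD('n) - 1 - 1)) * G (t\<^sup>2 + r\<^sup>2) * indicator {0..} r \<partial>lborel)"
      unfolding card[symmetric] by (rule nn_integral_radial_PiM[OF _ ne, of "\<lambda>s. G (t\<^sup>2 + s)"]) auto
    also have "(\<integral>\<^sup>+r. ennreal (r ^ (CARD('n) - 1 - 1)) * G (t\<^sup>2 + r\<^sup>2) * indicator {0..} r \<partial>lborel)
       = (\<integral>\<^sup>+r. ennreal (r ^ (CARD('n) - 2) * g (t\<^sup>2 + r\<^sup>2)) * indicator {0..} r \<partial>lborel)"
      by (intro nn_integral_cong) (auto simp: indicator_def Geq g0 ennreal_mult numeral_2_eq_2)
    finally have "(\<integral>\<^sup>+x. G (t\<^sup>2 + (\<Sum>i\<in>UNIV - {k}. (x i)\<^sup>2)) \<partial>(\<Pi>\<^sub>M i\<in>UNIV - {k}. lborel))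
      = radial_marginal CARD('n) g t" by (simp add: radial_marginal_def)
    moreover have "(\<integral>\<^sup>+x. G (t\<^sup>2 + (\<Sum>i\<in>UNIV - {k}. (x i)\<^sup>2)) * \<phi> (\<delta> \<bullet> \<mu> + ?\<sigma> * t) \<partial>(\<Pi>\<^sub>M i\<in>UNIV - {k}. lborel))
      = (\<integral>\<^sup>+x. G (t\<^sup>2 + (\<Sum>i\<in>UNIV - {k}. (x i)\<^sup>2)) \<partial>(\<Pi>\<^sub>M i\<in>UNIV - {k}. lborel)) * \<phi> (\<delta> \<bullet> \<mu> + ?\<sigma> * t)"
      by (rule nn_integral_multc) measurable
    ultimately show "(\<integral>\<^sup>+x. G (t\<^sup>2 + (\<Sum>i\<in>UNIV - {k}. (x i)\<^sup>2)) * \<phi> (\<delta> \<bullet> \<mu> + ?\<sigma> * t) \<partial>(\<Pi>\<^sub>M i\<in>UNIV - {k}. lborel))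
      = radial_marginal CARD('n) g t * \<phi> (\<delta> \<bullet> \<mu> + ?\<sigma> * t)" by simp
  qed
  finally show ?thesis by (simp add: h_def)
qed

text \<open>
  The marginal at \<open>z\<close> sees \<open>g\<close> on the whole half-line beyond \<open>z\<^sup>2\<close>, weighted by a function that
  is positive for \<open>r > 0\<close>. Returning from \<open>r\<close> to \<open>s = z\<^sup>2 + r\<^sup>2\<close> is harmless because
  differentiable maps preserve null sets.
\<close>
lemma radial_marginal_eq_0_imp_AE:
  assumes g: "set_borel_measurable borel {0..} g" and g0: "\<And>s. 0 \<le> s \<Longrightarrow> 0 \<le> g s"
    and n: "2 \<le> n" and zero: "radial_marginal n g z = 0"
  shows "AE s in lborel. z\<^sup>2 < s \<longrightarrow> g s = 0"
proof -
  have [measurable]: "(\<lambda>r. g (z\<^sup>2 + r\<^sup>2)) \<in> borel_measurable borel"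
    using measurable_compose[OF _ measurable_radial_generator[OF g], of "\<lambda>r. (z, r)" borel] by simp
  have "0 < sphere_area (n - 1)" using n by (intro sphere_area_pos) simp
  with zero have "(\<integral>\<^sup>+r. ennreal (r ^ (n - 2) * g (z\<^sup>2 + r\<^sup>2)) * indicator {0..} r \<partial>lborel) = 0"
    by (simp add: radial_marginal_def)
  then have "AE r in lborel. ennreal (r ^ (n - 2) * g (z\<^sup>2 + r\<^sup>2)) * indicator {0..} r = 0"
    by (subst (asm) nn_integral_0_iff_AE) auto
  then have "AE r in lborel. 0 < r \<longrightarrow> g (z\<^sup>2 + r\<^sup>2) = 0"
  proof eventually_elim
    case (elim r)
    show ?case
    proof
      assume "0 < r"
      with elim have "r ^ (n - 2) * g (z\<^sup>2 + r\<^sup>2) \<le> 0"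
        by (simp add: ennreal_eq_0_iff)
      with \<open>0 < r\<close> have "g (z\<^sup>2 + r\<^sup>2) \<le> 0"
        using zero_less_power[OF \<open>0 < r\<close>, of "n - 2"] by (auto simp: mult_le_0_iff)
      moreover have "0 \<le> g (z\<^sup>2 + r\<^sup>2)" by (simp add: g0)
      ultimately show "g (z\<^sup>2 + r\<^sup>2) = 0" by simp
    qed
  qed
  then have "AE r in lebesgue. 0 < r \<longrightarrow> g (z\<^sup>2 + r\<^sup>2) = 0"
    by (rule AE_completion)
  then have neg: "negligible {r. \<not> (0 < r \<longrightarrow> g (z\<^sup>2 + r\<^sup>2) = 0)}" (is "negligible ?N")
    by (simp add: AE_iff_null_sets completion.AE_iff_null_sets negligible_iff_null_sets eventually_ae_filter completion.complete2)
  have "negligible ((\<lambda>r. z\<^sup>2 + r\<^sup>2) ` ?N)"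
    using neg by (intro negligible_differentiable_image_negligible)
      (auto intro!: derivative_intros simp: differentiable_on_def)
  moreover have "{s. \<not> (z\<^sup>2 < s \<longrightarrow> g s = 0)} \<subseteq> (\<lambda>r. z\<^sup>2 + r\<^sup>2) ` ?N"
  proof
    fix s assume "s \<in> {s. \<not> (z\<^sup>2 < s \<longrightarrow> g s = 0)}"
    then have "s = z\<^sup>2 + (sqrt (s - z\<^sup>2))\<^sup>2" "0 < sqrt (s - z\<^sup>2)" "g s \<noteq> 0" by auto
    then show "s \<in> (\<lambda>r. z\<^sup>2 + r\<^sup>2) ` ?N"
      by (intro image_eqI[of _ _ "sqrt (s - z\<^sup>2)"]) auto
  qed
  ultimately have "negligible {s. \<not> (z\<^sup>2 < s \<longrightarrow> g s = 0)}"
    by (rule negligible_subset)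
  then have "AE s in lebesgue. z\<^sup>2 < s \<longrightarrow> g s = 0"
    by (auto simp: negligible_iff_null_sets eventually_ae_filter)
  then show ?thesis
    by (simp add: AE_completion_iff)
qed

section \<open>Mixtures and the Value-at-Risk equation\<close>

lemma mixture_projection_emeasure:
  fixes S :: "nat \<Rightarrow> real^'n^'n"
  assumes n: "2 \<le> CARD('n)" and \<beta>: "\<And>j. j \<in> J \<Longrightarrow> 0 \<le> \<beta> j" and J: "finite J"
    and S: "\<And>j. j \<in> J \<Longrightarrow> sym_pos_def (S j)"
    and g0: "\<And>j s. j \<in> J \<Longrightarrow> 0 \<le> s \<Longrightarrow> 0 \<le> g j s"
    and g: "\<And>j. j \<in> J \<Longrightarrow> set_borel_measurable borel {0..} (g j)"
    and f: "\<And>j. j \<in> J \<Longrightarrow> is_probability_density (elliptic_density (\<mu> j) (S j) (g j))"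
    and X: "distributed M lborel X (\<lambda>x. ennreal (\<Sum>j\<in>J. \<beta> j * elliptic_density (\<mu> j) (S j) (g j) x))"
    and \<delta>: "\<delta> \<noteq> 0" and B: "B \<in> sets borel"
  shows "emeasure (distr M borel (\<lambda>\<omega>. \<delta> \<bullet> X \<omega>)) B = (\<Sum>j\<in>J. ennreal (\<beta> j) *
    (\<integral>\<^sup>+z. radial_marginal CARD('n) (g j) z * indicator B (\<delta> \<bullet> \<mu> j + sqrt ((\<delta> v* S j) \<bullet> \<delta>) * z) \<partial>lborel))"
proof -
  let ?f = "\<lambda>j. elliptic_density (\<mu> j) (S j) (g j)"
  have fm: "?f j \<in> borel_measurable borel" and f0: "0 \<le> ?f j x" if "j \<in> J" for j x
    using f[OF that] by (auto simp: is_probability_density_def)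
  have Xm [measurable]: "X \<in> M \<rightarrow>\<^sub>M borel"
    using distributed_measurable[OF X] by simp
  have ind [measurable]: "(\<lambda>x. indicator B (\<delta> \<bullet> x) :: ennreal) \<in> borel_measurable borel"
    using B by measurable
  have set: "{x. \<delta> \<bullet> x \<in> B} \<in> sets lborel"
    using B by measurable
  have "emeasure (distr M borel (\<lambda>\<omega>. \<delta> \<bullet> X \<omega>)) B = emeasure M (X -` {x. \<delta> \<bullet> x \<in> B} \<inter> space M)"
    using B by (subst emeasure_distr) (auto intro!: arg_cong2[where f=emeasure])
  also have "\<dots> = (\<integral>\<^sup>+x. ennreal (\<Sum>j\<in>J. \<beta> j * ?f j x) * indicator {x. \<delta> \<bullet> x \<in> B} x \<partial>lborel)"
    using X set by (rule distributed_emeasure)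
  also have "\<dots> = (\<integral>\<^sup>+x. (\<Sum>j\<in>J. ennreal (\<beta> j) * (ennreal (?f j x) * indicator B (\<delta> \<bullet> x))) \<partial>lborel)"
  proof (rule nn_integral_cong)
    fix x
    have "ennreal (\<Sum>j\<in>J. \<beta> j * ?f j x) = (\<Sum>j\<in>J. ennreal (\<beta> j) * ennreal (?f j x))"
      using \<beta> f0 by (subst sum_ennreal[symmetric]) (auto simp: ennreal_mult intro!: sum.cong)
    then show "ennreal (\<Sum>j\<in>J. \<beta> j * ?f j x) * indicator {x. \<delta> \<bullet> x \<in> B} x
        = (\<Sum>j\<in>J. ennreal (\<beta> j) * (ennreal (?f j x) * indicator B (\<delta> \<bullet> x)))"
      by (simp add: sum_distrib_right mult.assoc indicator_def)
  qed
  also have "\<dots> = (\<Sum>j\<in>J. \<integral>\<^sup>+x. ennreal (\<beta> j) * (ennreal (?f j x) * indicator B (\<delta> \<bullet> x)) \<partial>lborel)"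
    using fm ind by (intro nn_integral_sum borel_measurable_times_ennreal) auto
  also have "\<dots> = (\<Sum>j\<in>J. ennreal (\<beta> j) * (\<integral>\<^sup>+x. ennreal (?f j x) * indicator B (\<delta> \<bullet> x) \<partial>lborel))"
    using fm ind by (intro sum.cong refl nn_integral_cmult borel_measurable_times_ennreal) auto
  also have "\<dots> = (\<Sum>j\<in>J. ennreal (\<beta> j) *
    (\<integral>\<^sup>+z. radial_marginal CARD('n) (g j) z * indicator B (\<delta> \<bullet> \<mu> j + sqrt ((\<delta> v* S j) \<bullet> \<delta>) * z) \<partial>lborel))"
    using B by (intro sum.cong refl arg_cong2[where f="(*)"] elliptic_density_projection n S \<delta> g g0 fm) auto
  finally show ?thesis .
qed

text \<open>
  If every component gives the strip \<open>{a<..<b}\<close> mass zero, each marginal vanishes at some point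
  \<open>z j\<close>, so each \<open>g j\<close> vanishes almost everywhere beyond \<open>(z j)\<^sup>2\<close>. Although the components see
  the strip at different places, beyond the largest of these squares they all vanish together
  almost everywhere, in particular somewhere.
\<close>
lemma jointly_zero_if_strips_null:
  assumes J: "finite J" and n: "2 \<le> n" and "a < b"
    and g: "\<And>j. j \<in> J \<Longrightarrow> set_borel_measurable borel {0..} (g j)"
    and g0: "\<And>j s. j \<in> J \<Longrightarrow> 0 \<le> s \<Longrightarrow> 0 \<le> g j s"
    and \<sigma>: "\<And>j. j \<in> J \<Longrightarrow> 0 < \<sigma> j"
    and null: "\<And>j. j \<in> J \<Longrightarrow> (\<integral>\<^sup>+z. radial_marginal n (g j) z * indicator {a<..<b} (c j + \<sigma> j * z) \<partial>lborel) = 0"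
  shows "\<exists>s\<ge>0. \<forall>j\<in>J. g j s = 0"
proof -
  have "\<exists>z. radial_marginal n (g j) z = 0" if j: "j \<in> J" for j
  proof (rule ccontr)
    assume nz: "\<nexists>z. radial_marginal n (g j) z = 0"
    note [measurable] = borel_measurable_radial_marginal[OF g[OF j], of n]
    have "AE z in lborel. radial_marginal n (g j) z * indicator {a<..<b} (c j + \<sigma> j * z) = 0"
      using null[OF j] by (subst (asm) nn_integral_0_iff_AE) auto
    then have "AE z in lborel. c j + \<sigma> j * z \<notin> {a<..<b}"
      by eventually_elim (use nz in \<open>auto simp: indicator_def\<close>)
    then have "AE z in lborel. z \<notin> {(a - c j) / \<sigma> j <..< (b - c j) / \<sigma> j}"
      by eventually_elim (use \<sigma>[OF j] in \<open>auto simp: field_simps\<close>)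
    then have "emeasure lborel {(a - c j) / \<sigma> j <..< (b - c j) / \<sigma> j} = 0"
      by (subst (asm) AE_iff_measurable[where N = "{(a - c j) / \<sigma> j <..< (b - c j) / \<sigma> j}"]) auto
    moreover have "(a - c j) / \<sigma> j < (b - c j) / \<sigma> j"
      using \<sigma>[OF j] \<open>a < b\<close> by (simp add: divide_strict_right_mono)
    ultimately show False using \<sigma>[OF j] \<open>a < b\<close> by simp
  qed
  then obtain z where z: "\<And>j. j \<in> J \<Longrightarrow> radial_marginal n (g j) (z j) = 0"
    by metis
  \<comment> \<open>The sum is a convenient upper bound of all \<open>(z j)\<^sup>2\<close>, also when \<open>J\<close> is empty.\<close>
  define s0 where "s0 = (\<Sum>j\<in>J. (z j)\<^sup>2)"
  have s0: "(z j)\<^sup>2 \<le> s0" if "j \<in> J" for j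
    unfolding s0_def using J that by (intro member_le_sum) auto
  have "0 \<le> s0" unfolding s0_def by (simp add: sum_nonneg)
  have "AE s in lborel. \<forall>j\<in>J. (z j)\<^sup>2 < s \<longrightarrow> g j s = 0"
    using J by (intro AE_finite_allI radial_marginal_eq_0_imp_AE[OF g g0 n z])
  then have AE: "AE s in lborel. \<not> (\<exists>s\<ge>0. \<forall>j\<in>J. g j s = 0) \<longrightarrow> s \<notin> {s0<..<s0 + 1}"
  proof eventually_elim
    case (elim s)
    show ?case
    proof (intro impI notI)
      assume no: "\<not> (\<exists>s\<ge>0. \<forall>j\<in>J. g j s = 0)" and "s \<in> {s0<..<s0 + 1}"
      then have "s0 < s" by simp
      then have "0 \<le> s" "\<forall>j\<in>J. g j s = 0"
        using elim s0 \<open>0 \<le> s0\<close> by (auto intro: le_less_trans)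
      with no show False by blast
    qed
  qed
  show ?thesis
  proof (rule ccontr)
    assume "\<not> ?thesis"
    with AE have "AE s in lborel. s \<notin> {s0<..<s0 + 1}" by simp
    then have "emeasure lborel {s0<..<s0 + 1} = 0"
      by (subst (asm) AE_iff_measurable[where N = "{s0<..<s0 + 1}"]) auto
    then show False by simp
  qed
qed

text \<open>
  Without atoms the distribution function is continuous, so it attains \<open>\<alpha>\<close>; charging every
  interval makes it strictly increasing, so it does so once.
\<close>
lemma (in real_distribution) cdf_eq_unique_solution:
  assumes atomless: "\<And>x. emeasure M {x} = 0" and full: "\<And>a b. a < b \<Longrightarrow> emeasure M {a<..<b} \<noteq> 0"
    and \<alpha>: "0 < \<alpha>" "\<alpha> < 1"
  shows "\<exists>!x. cdf M x = \<alpha>"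
proof -
  have cont: "isCont (cdf M) x" for x
    using atomless by (simp add: isCont_cdf measure_def)
  have mono: "cdf M a < cdf M b" if "a < b" for a b
  proof -
    have "0 < measure M {a<..<b}"
      using full[OF that] by (simp add: emeasure_eq_measure zero_less_measure_iff)
    also have "\<dots> \<le> measure M {a<..b}"
      by (intro finite_measure_mono) auto
    finally show ?thesis
      using cdf_diff_eq[OF that] by simp
  qed
  have "\<forall>\<^sub>F x in at_bot. cdf M x < \<alpha>"
    using cdf_lim_at_bot \<alpha>(1) by (rule order_tendstoD)
  then obtain a where a: "cdf M a < \<alpha>"
    by (metis eventually_at_bot_linorder order_refl)
  have "\<forall>\<^sub>F x in at_top. \<alpha> < cdf M x"
    using cdf_lim_at_top_prob \<alpha>(2) by (rule order_tendstoD)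
  then obtain b where b: "\<alpha> < cdf M b"
    by (metis eventually_at_top_linorder order_refl)
  have "a \<le> b"
    using a b mono[of b a] by linarith
  then obtain x where "cdf M x = \<alpha>"
    using IVT[of "cdf M" a \<alpha> b] a b cont by auto
  moreover have "x = y" if "cdf M x = cdf M y" for x y
    using mono[of x y] mono[of y x] that by (cases x y rule: linorder_cases) auto
  ultimately show ?thesis by metis
qed

theorem theorem3p3:
  fixes m :: nat
    and \<beta> :: "nat \<Rightarrow> real"
    and \<mu> :: "nat \<Rightarrow> real ^ 'n"
    and S :: "nat \<Rightarrow> real ^ 'n ^ 'n"
    and g :: "nat \<Rightarrow> real \<Rightarrow> real"
    and M :: "'a measure"
    and X :: "'a \<Rightarrow> real ^ 'n"
    and \<delta> :: "real ^ 'n"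
    and \<Delta>\<Pi> :: "'a \<Rightarrow> real"
    and \<alpha> :: real
  assumes n_ge_2: "2 \<le> CARD('n)"
    and m_ge_1: "1 \<le> m"
    and beta_pos: "\<forall>j\<in>{1..m}. 0 < \<beta> j"
    and beta_sum: "(\<Sum>j=1..m. \<beta> j) = 1"
    and S_spd: "\<forall>j\<in>{1..m}. sym_pos_def (S j)"
    and g_nonneg: "\<forall>j\<in>{1..m}. \<forall>s\<ge>0. 0 \<le> g j s"
    and g_integrable: "\<forall>j\<in>{1..m}. set_integrable lborel {0..} (g j)"
    and f_density: "\<forall>j\<in>{1..m}. is_probability_density (elliptic_density (\<mu> j) (S j) (g j))"
    and g_not_jointly_zero: "\<not> (\<exists>s\<ge>0. \<forall>j\<in>{1..m}. g j s = 0)"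
    and M_prob: "prob_space M"
    and X_density: "distributed M lborel X
          (\<lambda>x. ennreal (\<Sum>j=1..m. \<beta> j * elliptic_density (\<mu> j) (S j) (g j) x))"
    and delta_nonzero: "\<delta> \<noteq> 0"
    and DeltaPi_eq: "\<forall>\<omega>. \<Delta>\<Pi> \<omega> = (\<Sum>i\<in>UNIV. \<delta> $ i * X \<omega> $ i)"
    and alpha: "0 < \<alpha>" "\<alpha> < 1"
  shows "(\<exists>!v. measure M {\<omega> \<in> space M. \<Delta>\<Pi> \<omega> < - v} = \<alpha>) \<and>
    (\<forall>v. v = value_at_risk M \<Delta>\<Pi> \<alpha> \<longleftrightarrow>
      \<alpha> = (\<Sum>j=1..m. \<beta> j *
            elliptic_tail CARD('n) (g j) ((\<delta> \<bullet> \<mu> j + v) / sqrt ((\<delta> v* S j) \<bullet> \<delta>))))"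
proof -
  let ?\<sigma> = "\<lambda>j. sqrt ((\<delta> v* S j) \<bullet> \<delta>)"
  let ?J = "{1..m}"
  let ?r = "\<lambda>j. radial_marginal CARD('n) (g j)"
  let ?\<nu> = "distr M borel (\<lambda>\<omega>. \<delta> \<bullet> X \<omega>)"
  have \<Delta>: "\<Delta>\<Pi> = (\<lambda>\<omega>. \<delta> \<bullet> X \<omega>)"
    using DeltaPi_eq by (simp add: fun_eq_iff inner_vec_def)
  have g: "set_borel_measurable borel {0..} (g j)" if "j \<in> ?J" for j
  proof -
    have "(\<lambda>s. indicator {0..} s *\<^sub>R g j s) \<in> borel_measurable lborel"
      using g_integrable that unfolding set_integrable_def by (blast intro: borel_measurable_integrable)
    then show ?thesis by (simp add: set_borel_measurable_def)
  qed
  have Xm [measurable]: "X \<in> M \<rightarrow>\<^sub>M borel"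
    using distributed_measurable[OF X_density] by simp
  have \<sigma>: "0 < ?\<sigma> j" if "j \<in> ?J" for j
    using S_spd delta_nonzero that by (auto intro: sym_pos_def_pos)
  have b0: "0 \<le> \<beta> j" if "j \<in> ?J" for j
    using beta_pos that by (auto intro: less_imp_le)
  have law: "emeasure ?\<nu> B = (\<Sum>j\<in>?J. ennreal (\<beta> j) * (\<integral>\<^sup>+z. ?r j z * indicator B (\<delta> \<bullet> \<mu> j + ?\<sigma> j * z) \<partial>lborel))"
    if "B \<in> sets borel" for B
    by (rule mixture_projection_emeasure[OF n_ge_2 _ _ _ _ _ _ X_density delta_nonzero that])
       (use S_spd g_nonneg g f_density b0 in blast)+
  interpret M: prob_space M by (rule M_prob)
  interpret \<nu>: real_distribution ?\<nu>
    by (simp add: M.prob_space_distr real_distribution_def real_distribution_axioms_def)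
  have atomless: "emeasure ?\<nu> {c} = 0" for c
  proof -
    have "(\<integral>\<^sup>+z. ?r j z * indicator {c} (\<delta> \<bullet> \<mu> j + ?\<sigma> j * z) \<partial>lborel) = 0" if "j \<in> ?J" for j
    proof -
      have "AE z in lborel. ?r j z * indicator {c} (\<delta> \<bullet> \<mu> j + ?\<sigma> j * z) = 0"
        using \<sigma>[OF that] by (intro AE_I[of _ _ "{(c - \<delta> \<bullet> \<mu> j) / ?\<sigma> j}"]) (auto simp: indicator_def)
      then have "(\<integral>\<^sup>+z. ?r j z * indicator {c} (\<delta> \<bullet> \<mu> j + ?\<sigma> j * z) \<partial>lborel) = (\<integral>\<^sup>+z. 0 \<partial>(lborel :: real measure))"
        by (rule nn_integral_cong_AE)
      then show ?thesis by simp
    qed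
    then show ?thesis by (simp add: law)
  qed
  have full: "emeasure ?\<nu> {a<..<b} \<noteq> 0" if "a < b" for a b
  proof
    assume "emeasure ?\<nu> {a<..<b} = 0"
    then have prods: "\<forall>j\<in>?J. ennreal (\<beta> j) *
        (\<integral>\<^sup>+z. ?r j z * indicator {a<..<b} (\<delta> \<bullet> \<mu> j + ?\<sigma> j * z) \<partial>lborel) = 0"
      unfolding law[OF borel_open[OF open_greaterThanLessThan]] sum_eq_0_iff[OF finite_atLeastAtMost] .
    have null: "(\<integral>\<^sup>+z. ?r j z * indicator {a<..<b} (\<delta> \<bullet> \<mu> j + ?\<sigma> j * z) \<partial>lborel) = 0" if "j \<in> ?J" for j
    proof -
      have "0 < \<beta> j" using beta_pos that by blast
      then have "ennreal (\<beta> j) \<noteq> 0" by simp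
      moreover note bspec[OF prods that]
      ultimately show ?thesis by (simp only: mult_eq_0_iff simp_thms)
    qed
    have "\<exists>s\<ge>0. \<forall>j\<in>?J. g j s = 0"
      by (rule jointly_zero_if_strips_null[OF finite_atLeastAtMost n_ge_2 \<open>a < b\<close> g _ \<sigma> null])
         (use g_nonneg in blast)+
    with g_not_jointly_zero show False by blast
  qed
  have prob_eq_cdf: "measure M {\<omega> \<in> space M. \<Delta>\<Pi> \<omega> < - v} = cdf ?\<nu> (- v)" for v
  proof -
    have "measure M {\<omega> \<in> space M. \<Delta>\<Pi> \<omega> < - v} = measure ?\<nu> {..< - v}"
      unfolding \<Delta> by (subst measure_distr) (auto intro!: arg_cong2[where f=measure])
    also have "\<dots> = measure ?\<nu> {.. - v}"
    proof -
      have "{.. - v} = {..< - v} \<union> {- v}" by auto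
      then have "measure ?\<nu> {.. - v} = measure ?\<nu> {..< - v} + measure ?\<nu> {- v}"
        by (simp only:) (rule \<nu>.finite_measure_Union, auto)
      then show ?thesis using atomless[of "- v"] by (simp add: measure_def)
    qed
    finally show ?thesis by (simp add: cdf_def)
  qed
  have tail: "cdf ?\<nu> (- v) = (\<Sum>j=1..m. \<beta> j * elliptic_tail CARD('n) (g j) ((\<delta> \<bullet> \<mu> j + v) / ?\<sigma> j))" for v
  proof -
    let ?t = "\<lambda>j. elliptic_tail CARD('n) (g j) ((\<delta> \<bullet> \<mu> j + v) / ?\<sigma> j)"
    have t: "(\<integral>\<^sup>+z. ?r j z * indicator {.. - v} (\<delta> \<bullet> \<mu> j + ?\<sigma> j * z) \<partial>lborel) = ennreal (?t j)"
      and t0: "0 \<le> ?t j" if j: "j \<in> ?J" for j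
    proof -
      have f: "elliptic_density (\<mu> j) (S j) (g j) \<in> borel_measurable borel"
        "(\<integral>\<^sup>+x. ennreal (elliptic_density (\<mu> j) (S j) (g j) x) \<partial>lborel) = 1"
        using f_density j by (auto simp: is_probability_density_def)
      have g0: "\<And>s. 0 \<le> s \<Longrightarrow> 0 \<le> g j s"
        using g_nonneg j by blast
      have "(\<integral>\<^sup>+z. ?r j z \<partial>lborel) = 1"
        using elliptic_density_projection[OF n_ge_2 _ delta_nonzero g[OF j] g0 f(1), of "\<lambda>_. 1"] S_spd j f(2)
        by simp
      then have fin: "(\<integral>\<^sup>+z. ?r j z \<partial>lborel) < \<infinity>" by simp
      show "0 \<le> ?t j"
        by (rule elliptic_tail_eq_nn_integral(2)[OF n_ge_2 g[OF j] g0 fin])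
      have "indicator {.. - v} (\<delta> \<bullet> \<mu> j + ?\<sigma> j * z) = (indicator {.. - ((\<delta> \<bullet> \<mu> j + v) / ?\<sigma> j)} z :: ennreal)" for z
        using \<sigma>[OF j] by (auto simp: indicator_def field_simps)
      then show "(\<integral>\<^sup>+z. ?r j z * indicator {.. - v} (\<delta> \<bullet> \<mu> j + ?\<sigma> j * z) \<partial>lborel) = ennreal (?t j)"
        by (simp only: elliptic_tail_eq_nn_integral(1)[OF n_ge_2 g[OF j] g0 fin])
    qed
    have "ennreal (cdf ?\<nu> (- v)) = emeasure ?\<nu> {.. - v}"
      by (simp add: cdf_def \<nu>.emeasure_eq_measure)
    also have "\<dots> = (\<Sum>j\<in>?J. ennreal (\<beta> j) * ennreal (?t j))"
      unfolding law[OF atMost_borel] by (intro sum.cong refl arg_cong2[where f="(*)"] t)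
    also have "\<dots> = (\<Sum>j\<in>?J. ennreal (\<beta> j * ?t j))"
      by (intro sum.cong refl ennreal_mult[symmetric] b0 t0)
    also have "\<dots> = ennreal (\<Sum>j\<in>?J. \<beta> j * ?t j)"
      by (intro sum_ennreal mult_nonneg_nonneg b0 t0)
    finally have "ennreal (cdf ?\<nu> (- v)) = ennreal (\<Sum>j\<in>?J. \<beta> j * ?t j)" .
    moreover have "0 \<le> (\<Sum>j\<in>?J. \<beta> j * ?t j)"
      by (intro sum_nonneg mult_nonneg_nonneg b0 t0)
    ultimately show ?thesis
      using \<nu>.cdf_nonneg by (simp only: ennreal_inj)
  qed
  have "\<exists>!x. cdf ?\<nu> x = \<alpha>"
    using atomless full alpha by (rule \<nu>.cdf_eq_unique_solution)
  then obtain x where x: "cdf ?\<nu> x = \<alpha>" and unique: "\<And>y. cdf ?\<nu> y = \<alpha> \<Longrightarrow> y = x"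
    by blast
  have ex1: "\<exists>!v. measure M {\<omega> \<in> space M. \<Delta>\<Pi> \<omega> < - v} = \<alpha>"
    unfolding prob_eq_cdf
  proof (rule ex1I)
    show "cdf ?\<nu> (- (- x)) = \<alpha>" using x by simp
    show "v = - x" if "cdf ?\<nu> (- v) = \<alpha>" for v
      using unique[OF that] by simp
  qed
  have VaR: "v = value_at_risk M \<Delta>\<Pi> \<alpha> \<longleftrightarrow> measure M {\<omega> \<in> space M. \<Delta>\<Pi> \<omega> < - v} = \<alpha>" for v
    unfolding value_at_risk_def
  proof
    assume "v = (THE v. measure M {\<omega> \<in> space M. \<Delta>\<Pi> \<omega> < - v} = \<alpha>)"
    then show "measure M {\<omega> \<in> space M. \<Delta>\<Pi> \<omega> < - v} = \<alpha>"
      using theI'[OF ex1] by (simp only:)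
  next
    assume "measure M {\<omega> \<in> space M. \<Delta>\<Pi> \<omega> < - v} = \<alpha>"
    then show "v = (THE v. measure M {\<omega> \<in> space M. \<Delta>\<Pi> \<omega> < - v} = \<alpha>)"
      by (rule the1_equality[OF ex1, symmetric])
  qed
  show ?thesis
  proof (intro conjI allI)
    show "\<exists>!v. measure M {\<omega> \<in> space M. \<Delta>\<Pi> \<omega> < - v} = \<alpha>" by (rule ex1)
    show "v = value_at_risk M \<Delta>\<Pi> \<alpha> \<longleftrightarrow>
      \<alpha> = (\<Sum>j=1..m. \<beta> j * elliptic_tail CARD('n) (g j) ((\<delta> \<bullet> \<mu> j + v) / ?\<sigma> j))" for v
      unfolding VaR prob_eq_cdf tail by (rule eq_commute)
  qed
qed

end
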